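(* Let $N\ge 1$ and let $$F(\chi,\delta)=\sum_{\lambda\subseteq (N^{N-1})} s_{(\lambda,N)}(\delta_1,\dots,\delta_N)\, s_{\lambda^{\vee}}(\chi_1,\dots,\chi_N),$$ where $\lambda^\vee=\overline{(\lambda,N)}$ is the complementary partition of $(\lambda,N)$ within the square $(N^N)$, and let $F(\delta,\chi)$ be obtained from $F(\chi,\delta)$ by exchanging the roles of the $\delta_i$ and the $\chi_i$. When all variables $\delta_1,\dots,\delta_N$ are replaced by a single variable $\delta$ and all variables $\chi_1,\dots,\chi_N$ are replaced by a single variable $\chi$, one has $$F(\chi,\delta)+F(\delta,\chi)=\sum_{k=0}^{N^2}\binom{N^2}{k}\,\delta^k\,\chi^{N^2-k}.$$
   Context: The sum defining $F$ runs over all partitions $\lambda$ whose Ferrers diagram fits in the rectangle $(N^{N-1})$ with $N-1$ rows of length $N$ (including the empty partition), and $(\lambda,N)$ denotes the partition obtained from $\lambda$ by adding one further part equal to $N$, as largest part. The Schur function $s_\mu(x_1,\dots,x_N)$ is the sum of $\prod x_i$ (product over all entries $i$ of $T$) for $T$ running over all Young tableaux of shape $\mu$ with entries in $\{1,\dots,N\}$ (rows weakly increasing, columns strictly increasing). Complementary partition: if $\mu\subseteq (N^N)$ has row lengths $\ell_1\ge\dots\ge\ell_N\ge 0$ (padded by zeros), let $\nu$ be the partition with parts $N-\ell_N\ge\dots\ge N-\ell_1$; then $\overline{\mu}$ is the conjugate (transpose) of $\nu$. *)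

theory Defs
  imports Complex_Main "HOL-Library.FuncSet"
begin

text \<open>
  A partition is the weakly decreasing list of its nonzero parts, so that every partition has
  exactly one representation; the empty partition is the empty list.
\<close>

definition is_partition :: "nat list \<Rightarrow> bool" where
  "is_partition \<mu> \<longleftrightarrow> sorted_wrt (\<ge>) \<mu> \<and> 0 \<notin> set \<mu>"

text \<open>Partitions whose Ferrers diagram fits in the rectangle with \<open>r\<close> rows of length \<open>c\<close>.\<close>

definition partitions_in_box :: "nat \<Rightarrow> nat \<Rightarrow> nat list set" where
  "partitions_in_box r c = {\<mu>. is_partition \<mu> \<and> length \<mu> \<le> r \<and> (\<forall>p\<in>set \<mu>. p \<le> c)}"

definition row_length :: "nat list \<Rightarrow> nat \<Rightarrow> nat" where
  "row_length \<mu> i = (if i < length \<mu> then \<mu> ! i else 0)"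

text \<open>Cells are pairs (row, column), counted from 0.\<close>

definition diagram :: "nat list \<Rightarrow> (nat \<times> nat) set" where
  "diagram \<mu> = {(i, j). i < length \<mu> \<and> j < \<mu> ! i}"

definition conjugate :: "nat list \<Rightarrow> nat list" where
  "conjugate \<mu> = map (\<lambda>j. card {i. (i, j) \<in> diagram \<mu>}) [0..<row_length \<mu> 0]"

text \<open>
  For \<open>\<mu>\<close> contained in the square with \<open>N\<close> rows of length \<open>N\<close>: the list before filtering is
  \<open>N - l\<^sub>N \<ge> \<dots> \<ge> N - l\<^sub>1\<close>, where \<open>l\<^sub>1 \<ge> \<dots> \<ge> l\<^sub>N\<close> are the row lengths of \<open>\<mu>\<close>, padded by zeros.
\<close>

definition complementary :: "nat \<Rightarrow> nat list \<Rightarrow> nat list" where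
  "complementary N \<mu> =
     conjugate (filter (\<lambda>p. 0 < p) (map (\<lambda>i. N - row_length \<mu> i) (rev [0..<N])))"

text \<open>
  Tableaux are extensional functions on the cells (undefined elsewhere), so that two tableaux are
  equal exactly if they have the same entries.
\<close>

definition tableaux :: "nat \<Rightarrow> nat list \<Rightarrow> (nat \<times> nat \<Rightarrow> nat) set" where
  "tableaux n \<mu> = {T \<in> diagram \<mu> \<rightarrow>\<^sub>E {1..n}.
     (\<forall>i j j'. (i, j) \<in> diagram \<mu> \<and> (i, j') \<in> diagram \<mu> \<and> j < j' \<longrightarrow> T (i, j) \<le> T (i, j')) \<and>
     (\<forall>i i' j. (i, j) \<in> diagram \<mu> \<and> (i', j) \<in> diagram \<mu> \<and> i < i' \<longrightarrow> T (i, j) < T (i', j))}"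

text \<open>
  The value of the Schur function in \<open>n\<close> variables at \<open>(x 1, \<dots>, x n)\<close>, for \<open>x\<close> in an arbitrary
  commutative ring; the formal polynomial is the case where the \<open>x i\<close> are indeterminates.
\<close>

definition schur :: "nat \<Rightarrow> nat list \<Rightarrow> (nat \<Rightarrow> 'a::comm_ring_1) \<Rightarrow> 'a" where
  "schur n \<mu> x = (\<Sum>T\<in>tableaux n \<mu>. \<Prod>c\<in>diagram \<mu>. x (T c))"

text \<open>The partition \<open>(\<mu>, N)\<close> is \<open>N # \<mu>\<close>, since the largest part comes first.\<close>

definition F :: "nat \<Rightarrow> (nat \<Rightarrow> 'a::comm_ring_1) \<Rightarrow> (nat \<Rightarrow> 'a) \<Rightarrow> 'a" where
  "F N \<chi> \<delta> = (\<Sum>\<mu>\<in>partitions_in_box (N - 1) N.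
     schur N (N # \<mu>) \<delta> * schur N (complementary N (N # \<mu>)) \<chi>)"

text \<open>The sums and products above range over finite sets.\<close>

lemma finite_diagram: "finite (diagram \<mu>)"
proof -
  have "diagram \<mu> = (SIGMA i:{..<length \<mu>}. {..<\<mu> ! i})"
    by (auto simp: diagram_def)
  then show ?thesis by simp
qed

lemma finite_tableaux: "finite (tableaux n \<mu>)"
proof (rule finite_subset)
  show "tableaux n \<mu> \<subseteq> diagram \<mu> \<rightarrow>\<^sub>E {1..n}"
    by (auto simp: tableaux_def)
  show "finite (diagram \<mu> \<rightarrow>\<^sub>E {1..n})"
    by (intro finite_PiE finite_diagram) simp
qed

lemma finite_partitions_in_box: "finite (partitions_in_box r c)"
proof (rule finite_subset)
  show "partitions_in_box r c \<subseteq> {\<mu>. set \<mu> \<subseteq> {..c} \<and> length \<mu> \<le> r}"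
    by (auto simp: partitions_in_box_def)
  show "finite {\<mu>. set \<mu> \<subseteq> {..c} \<and> length \<mu> \<le> r}"
    by (rule finite_lists_length_le) simp
qed

end

theory Submission imports Defs begin

text \<open>
  Write \<open>\<mu> = (\<lambda>, N)\<close>. Then \<open>F(\<chi>, \<delta>)\<close> sums \<open>s\<^sub>\<mu>(\<delta>) s\<^sub>\<mu>'(\<chi>)\<close>, with \<open>\<mu>'\<close> the complementary
  partition, over the \<open>\<mu>\<close> in the square whose first row is full. Complementation is an involution
  which exchanges these with the \<open>\<mu>\<close> whose first row is not full, so \<open>F(\<chi>, \<delta>) + F(\<delta>, \<chi>)\<close> is the
  same sum over all \<open>\<mu>\<close> in the square. By the dual Cauchy identity this is
  \<open>\<Prod>\<^sub>i\<^sub>,\<^sub>j (\<delta>\<^sub>i + \<chi>\<^sub>j)\<close>.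

  The dual Cauchy identity follows by induction on the number of variables \<open>\<chi>\<^sub>j\<close>: removing a
  horizontal strip from \<open>\<mu>'\<close> amounts to removing a vertical strip from \<open>\<mu>\<close>, so that the branching
  rule for \<open>s\<^sub>\<mu>'\<close> turns the step into the Pieri rule for vertical strips. The Pieri rule is proved
  by induction on the number of variables \<open>\<delta>\<^sub>i\<close>. There the operators that add a horizontal and
  remove a vertical strip must be interchanged; once the two outer shapes are fixed, the rows of the
  intermediate shape vary independently, and both sides become products over the rows.
\<close>

section \<open>Interlacing sequences and sums over Gelfand-Tsetlin patterns\<close>

lemma sum_swap_dependent:
  fixes h :: "'b \<Rightarrow> 'c \<Rightarrow> 'a::comm_monoid_add"
  assumes "finite A" "finite C" "\<And>a. a \<in> A \<Longrightarrow> finite (B a)" "\<And>c. c \<in> C \<Longrightarrow> finite (D c)"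
    and "\<And>a c. a \<in> A \<and> c \<in> B a \<longleftrightarrow> c \<in> C \<and> a \<in> D c"
  shows "(\<Sum>a\<in>A. \<Sum>c\<in>B a. h a c) = (\<Sum>c\<in>C. \<Sum>a\<in>D c. h a c)"
proof -
  have "(\<Sum>a\<in>A. \<Sum>c\<in>B a. h a c) = (\<Sum>(a, c)\<in>Sigma A B. h a c)"
    using assms by (intro sum.Sigma) auto
  also have "\<dots> = (\<Sum>(c, a)\<in>Sigma C D. h a c)"
    by (intro sum.reindex_bij_witness[where i = prod.swap and j = prod.swap])
      (auto dest: assms(5)[THEN iffD1, OF conjI] assms(5)[THEN iffD2, OF conjI])
  also have "\<dots> = (\<Sum>c\<in>C. \<Sum>a\<in>D c. h a c)"
    using assms by (intro sum.Sigma[symmetric]) auto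
  finally show ?thesis .
qed

definition antitone_below :: "nat \<Rightarrow> (nat \<Rightarrow> nat) \<Rightarrow> bool" where
  "antitone_below n f \<longleftrightarrow> (\<forall>i j. i \<le> j \<and> j < n \<longrightarrow> f j \<le> f i)"

lemma antitone_belowD: "antitone_below n f \<Longrightarrow> i \<le> j \<Longrightarrow> j < n \<Longrightarrow> f j \<le> f i"
  by (simp add: antitone_below_def)

lemma antitone_belowI_Suc:
  assumes "\<And>i. Suc i < n \<Longrightarrow> f (Suc i) \<le> f i"
  shows "antitone_below n f"
  unfolding antitone_below_def
proof (intro allI impI)
  fix i j assume "i \<le> j \<and> j < n"
  then have "i \<le> j" "j < n" by auto
  then show "f j \<le> f i"
    by (induction rule: dec_induct) (use assms in \<open>auto intro: order_trans\<close>)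
qed

text \<open>Writing this as a product of intervals shows that the entries vary independently; being
  extensional keeps the set finite.\<close>

abbreviation interlacing :: "nat \<Rightarrow> (nat \<Rightarrow> nat) \<Rightarrow> (nat \<Rightarrow> nat) set" where
  "interlacing n f \<equiv> \<Pi>\<^sub>E i\<in>{..<n}. {f (Suc i)..f i}"

lemma antitone_below_interlacing:
  assumes "g \<in> interlacing n f"
  shows "antitone_below n g"
proof (rule antitone_belowI_Suc)
  fix i assume "Suc i < n"
  then have "g (Suc i) \<le> f (Suc i)" "f (Suc i) \<le> g i"
    using assms by (auto simp: PiE_iff)
  then show "g (Suc i) \<le> g i" by simp
qed

lemma antitone_below_if_interlacing:
  assumes "g \<in> interlacing n f"
  shows "antitone_below (Suc n) f"
proof (rule antitone_belowI_Suc)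
  fix i assume "Suc i < Suc n"
  then have "f (Suc i) \<le> g i" "g i \<le> f i"
    using assms by (auto simp: PiE_iff)
  then show "f (Suc i) \<le> f i" by simp
qed

lemma finite_interlacing: "finite (interlacing n f)"
  by (intro finite_PiE) auto

text \<open>
  The sum over Gelfand-Tsetlin patterns with top row \<open>f 0 \<ge> \<dots> \<ge> f (n - 1)\<close>, by which a Schur
  function satisfies the branching rule. If \<open>f\<close> is not weakly decreasing, the sum is empty.
\<close>

fun gt_sum :: "(nat \<Rightarrow> 'a::comm_ring_1) \<Rightarrow> nat \<Rightarrow> (nat \<Rightarrow> nat) \<Rightarrow> 'a" where
  "gt_sum x 0 f = 1"
| "gt_sum x (Suc n) f =
     (\<Sum>g\<in>interlacing n f. x (Suc n) ^ ((\<Sum>i<Suc n. f i) - (\<Sum>i<n. g i)) * gt_sum x n g)"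

text \<open>Lets a shape be replaced by its restriction to \<open>{..<n}\<close>, which differs only
  in values that \<open>gt_sum\<close> never reads.\<close>

lemma gt_sum_cong:
  assumes "\<And>i. i < n \<Longrightarrow> f i = g i"
  shows "gt_sum x n f = gt_sum x n g"
proof (cases n)
  case (Suc m)
  have "interlacing m f = interlacing m g"
    using assms Suc by (intro PiE_cong) auto
  moreover have "(\<Sum>i<Suc m. f i) = (\<Sum>i<Suc m. g i)"
    using assms Suc by (intro sum.cong) auto
  ultimately show ?thesis using Suc by (simp del: sum.lessThan_Suc)
qed simp

lemma gt_sum_eq_0:
  assumes "\<not> antitone_below n f"
  shows "gt_sum x n f = 0"
proof (cases n)
  case 0
  then show ?thesis using assms by (simp add: antitone_below_def)
next
  case (Suc m)
  then have "interlacing m f = {}"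
    using assms antitone_below_if_interlacing by blast
  then show ?thesis by (simp only: Suc gt_sum.simps sum.empty)
qed

section \<open>The Pieri rule for vertical strips\<close>

text \<open>
  The contribution of a single row to the two ways of passing between the shapes \<open>a\<close> and \<open>b\<close>: via a
  larger row \<open>l\<close> (\<open>l / a\<close> in a horizontal, \<open>l / b\<close> in a vertical strip) and via a smaller row \<open>k\<close>
  (\<open>b / k\<close> in a horizontal, \<open>a / k\<close> in a vertical strip). Here \<open>p\<close> is the row of \<open>a\<close> above and \<open>b'\<close>
  the row of \<open>b\<close> below. The border factor carries the discrepancy from one row to the next.
\<close>

definition add_factor :: "'a::comm_ring_1 \<Rightarrow> 'a \<Rightarrow> nat \<Rightarrow> nat \<Rightarrow> nat \<Rightarrow> 'a" where
  "add_factor x y p b a = (\<Sum>l\<in>{max a b..min p (Suc b)}. x ^ (l - a) * y ^ (Suc b - l))"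

definition remove_factor :: "'a::comm_ring_1 \<Rightarrow> 'a \<Rightarrow> nat \<Rightarrow> nat \<Rightarrow> nat \<Rightarrow> 'a" where
  "remove_factor x y b b' a = (\<Sum>k\<in>{max b' (a - 1)..min a b}. x ^ (b - k) * y ^ (Suc k - a))"

definition border_factor :: "'a::comm_ring_1 \<Rightarrow> 'a \<Rightarrow> nat \<Rightarrow> nat \<Rightarrow> 'a" where
  "border_factor x y p b = (\<Sum>l\<in>{b..min p (Suc b)}. x ^ (l - b) * y ^ (Suc b - l))"

lemma border_factor_eq:
  "border_factor x y p b = (if p < b then 0 else if p = b then y else x + y)"
proof -
  have "{b..min p (Suc b)} = (if p < b then {} else if p = b then {b} else {b, Suc b})"
    by auto
  then show ?thesis by (auto simp: border_factor_def)
qed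

text \<open>If \<open>a \<le> b\<close>, each row factor is \<open>x ^ (b - a)\<close> times the
  border factor from the other side of the equation. If \<open>a = Suc b\<close>, both row factors
  are 1 and both border factors are \<open>x + y\<close>. Beyond that both row factors are empty
  sums. The alternative \<open>Suc b < a\<close> is needed in the first row, where \<open>p\<close>
  is not an entry of \<open>a\<close>.\<close>

lemma factor_exchange:
  fixes x y :: "'a::comm_ring_1"
  assumes "a \<le> p \<or> Suc b < a" "b' \<le> b"
  shows "add_factor x y p b a * border_factor x y a b' =
    border_factor x y p b * remove_factor x y b b' a"
proof -
  consider "Suc b < a" | "a = Suc b" | "a \<le> b" by linarith
  then show ?thesis
  proof cases
    case 1
    then show ?thesis by (simp add: add_factor_def remove_factor_def)
  next
    case 2
    then have "{max a b..min p (Suc b)} = {Suc b}" "{max b' (a - 1)..min a b} = {b}"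
      using assms by auto
    then show ?thesis
      using 2 assms by (simp add: add_factor_def remove_factor_def border_factor_eq)
  next
    case 3
    have "add_factor x y p b a = x ^ (b - a) * border_factor x y p b"
      unfolding add_factor_def border_factor_def sum_distrib_left
      using 3 by (intro sum.cong) (auto simp: max_def power_add[symmetric] mult.assoc[symmetric])
    moreover have "remove_factor x y b b' a = x ^ (b - a) * border_factor x y a b'"
    proof -
      have "{max b' (a - 1)..min a b} =
          (if a < b' then {} else if a = b' then {a} else {a - 1, a})"
        using 3 by auto
      moreover have "b - (a - 1) = Suc (b - a)" if "b' < a" using that 3 by simp
      ultimately show ?thesis
        using 3 by (auto simp: remove_factor_def border_factor_eq algebra_simps Suc_diff_le)
    qed
    ultimately show ?thesis by (simp add: algebra_simps)
  qed
qed

text \<open>Telescoping: each use of \<open>factor_exchange\<close> moves the border factor down one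
  row. The artificial row \<open>p 0 = Suc (b 0)\<close> makes the initial border factor equal to
  \<open>x + y\<close>.\<close>

lemma prod_factor_exchange:
  fixes x y :: "'a::comm_ring_1" and a b :: "nat \<Rightarrow> nat"
  assumes "antitone_below (Suc n) b" "antitone_below n a"
  defines "p \<equiv> \<lambda>i. if i = 0 then Suc (b 0) else a (i - 1)"
  shows "(\<Prod>i<n. add_factor x y (p i) (b i) (a i)) * border_factor x y (p n) (b n) =
    (x + y) * (\<Prod>i<n. remove_factor x y (b i) (b (Suc i)) (a i))"
proof -
  have "(\<Prod>i<m. add_factor x y (p i) (b i) (a i)) * border_factor x y (p m) (b m) =
    (x + y) * (\<Prod>i<m. remove_factor x y (b i) (b (Suc i)) (a i))" if "m \<le> n" for m
    using that
  proof (induction m)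
    case 0
    then show ?case by (simp add: border_factor_eq p_def)
  next
    case (Suc m)
    have "a m \<le> p m \<or> Suc (b m) < a m"
      using Suc.prems antitone_belowD[OF assms(2), of "m - 1" m] by (auto simp: p_def)
    moreover have "b (Suc m) \<le> b m"
      using Suc.prems antitone_belowD[OF assms(1), of m "Suc m"] by simp
    ultimately have "add_factor x y (p m) (b m) (a m) * border_factor x y (p (Suc m)) (b (Suc m)) =
        border_factor x y (p m) (b m) * remove_factor x y (b m) (b (Suc m)) (a m)"
      using factor_exchange[of "a m" "p m" "b m" "b (Suc m)" x y] by (simp add: p_def)
    then have "(\<Prod>i<Suc m. add_factor x y (p i) (b i) (a i)) *
          border_factor x y (p (Suc m)) (b (Suc m)) =
        ((\<Prod>i<m. add_factor x y (p i) (b i) (a i)) * border_factor x y (p m) (b m)) *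
          remove_factor x y (b m) (b (Suc m)) (a m)"
      by (simp add: mult.assoc)
    then show ?case
      using Suc by (simp add: mult.assoc)
  qed
  then show ?thesis by simp
qed

lemma sum_diff_distrib:
  fixes f g :: "nat \<Rightarrow> nat"
  assumes "\<And>i. i \<in> A \<Longrightarrow> g i \<le> f i"
  shows "sum f A - sum g A = (\<Sum>i\<in>A. f i - g i)"
  using sum_subtractf_nat[of A g f] assms by simp

text \<open>
  The exponent counts the rows of \<open>l\<close> that were not enlarged. The sum may run over all \<open>l\<close>, since
  \<open>gt_sum\<close> vanishes if \<open>l\<close> is not a partition.
\<close>

lemma gt_sum_pieri:
  fixes x :: "nat \<Rightarrow> 'a::comm_ring_1"
  assumes "antitone_below n b"
  shows "(\<Sum>l\<in>(\<Pi>\<^sub>E i\<in>{..<n}. {b i..Suc (b i)}). gt_sum x n l * y ^ (\<Sum>i<n. Suc (b i) - l i)) =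
    (\<Prod>i<n. x (Suc i) + y) * gt_sum x n b"
  using assms
proof (induction n arbitrary: b)
  case 0
  then show ?case by simp
next
  case (Suc n)
  define X where "X = x (Suc n)"
  \<comment> \<open>No row of \<open>a\<close> lies above row 0; there the vertical strip supplies
    the bound \<open>Suc (b 0)\<close>.\<close>
  define p where "p a i = (if i = 0 then Suc (b 0) else a (i - 1))" for a :: "nat \<Rightarrow> nat" and i
  \<comment> \<open>A finite range containing every outer shape \<open>a\<close>, whether it is
    reached through \<open>l\<close> or through \<open>k\<close>.\<close>
  define C where "C = (\<Pi>\<^sub>E i\<in>{..<n}. {0..Suc (b i)})"
  \<comment> \<open>\<open>M\<close> and \<open>K\<close> are the ranges of a single row of the
    intermediate shapes \<open>l\<close> and \<open>k\<close>, and \<open>w\<close> and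
    \<open>v\<close> are its weights. Row \<open>n\<close> of \<open>l\<close> is exceptional
    because \<open>a\<close> has only \<open>n\<close> rows.\<close>
  define M where "M a i = {(if i < n then max (a i) (b i) else b i)..min (p a i) (Suc (b i))}"
    for a i
  define K where "K a i = {max (b (Suc i)) (a i - 1)..min (a i) (b i)}" for a i
  define w where "w a i l = X ^ (if i < n then l - a i else l) * y ^ (Suc (b i) - l)" for a i l
  define v where "v a i k = X ^ (b i - k) * y ^ (Suc k - a i)" for a i k
  have swapL: "l \<in> (\<Pi>\<^sub>E i\<in>{..<Suc n}. {b i..Suc (b i)}) \<and> a \<in> interlacing n l \<longleftrightarrow>
      a \<in> C \<and> l \<in> (\<Pi>\<^sub>E i\<in>{..<Suc n}. M a i)" for a l
  proof
    assume A: "l \<in> (\<Pi>\<^sub>E i\<in>{..<Suc n}. {b i..Suc (b i)}) \<and> a \<in> interlacing n l"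
    then have l: "b i \<le> l i" "l i \<le> Suc (b i)" if "i < Suc n" for i
      using that by (auto simp: PiE_iff)
    from A have a: "l (Suc i) \<le> a i" "a i \<le> l i" if "i < n" for i
      using that by (auto simp: PiE_iff)
    have "l i \<le> p a i" if "i < Suc n" for i
      using that l[of i] a[of "i - 1"] by (cases i) (auto simp: p_def)
    moreover have "a i \<le> Suc (b i)" if "i < n" for i
      using that l(2)[of i] a(2)[of i] by simp
    ultimately show "a \<in> C \<and> l \<in> (\<Pi>\<^sub>E i\<in>{..<Suc n}. M a i)"
      using A l a by (auto simp: PiE_iff C_def M_def)
  next
    assume A: "a \<in> C \<and> l \<in> (\<Pi>\<^sub>E i\<in>{..<Suc n}. M a i)"
    then have l: "b i \<le> l i" "l i \<le> p a i" "l i \<le> Suc (b i)" "i < n \<longrightarrow> a i \<le> l i"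
      if "i < Suc n" for i
      using that by (auto simp: PiE_iff M_def split: if_splits)
    have "l (Suc i) \<le> a i" if "i < n" for i
      using that l(2)[of "Suc i"] by (simp add: p_def)
    then show "l \<in> (\<Pi>\<^sub>E i\<in>{..<Suc n}. {b i..Suc (b i)}) \<and> a \<in> interlacing n l"
      using A l by (auto simp: PiE_iff C_def)
  qed
  have swapR: "k \<in> interlacing n b \<and> a \<in> (\<Pi>\<^sub>E i\<in>{..<n}. {k i..Suc (k i)}) \<longleftrightarrow>
      a \<in> C \<and> k \<in> (\<Pi>\<^sub>E i\<in>{..<n}. K a i)" for a k
  proof -
    have "k i \<in> {b (Suc i)..b i} \<and> a i \<in> {k i..Suc (k i)} \<longleftrightarrow>
        a i \<in> {0..Suc (b i)} \<and> k i \<in> K a i" for i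
      by (auto simp: K_def)
    then show ?thesis unfolding PiE_iff C_def by blast
  qed
  have finC: "finite C" unfolding C_def by (intro finite_PiE) auto
  have "(\<Sum>l\<in>(\<Pi>\<^sub>E i\<in>{..<Suc n}. {b i..Suc (b i)}).
        gt_sum x (Suc n) l * y ^ (\<Sum>i<Suc n. Suc (b i) - l i)) =
      (\<Sum>l\<in>(\<Pi>\<^sub>E i\<in>{..<Suc n}. {b i..Suc (b i)}). \<Sum>a\<in>interlacing n l.
        gt_sum x n a * (\<Prod>i<Suc n. w a i (l i)))"
  proof (rule sum.cong[OF refl])
    fix l assume l: "l \<in> (\<Pi>\<^sub>E i\<in>{..<Suc n}. {b i..Suc (b i)})"
    have "X ^ ((\<Sum>i<Suc n. l i) - (\<Sum>i<n. a i)) * y ^ (\<Sum>i<Suc n. Suc (b i) - l i) =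
        (\<Prod>i<Suc n. w a i (l i))" if a: "a \<in> interlacing n l" for a
    proof -
      have le: "a i \<le> l i" if "i \<in> {..<n}" for i
        using a that by (auto simp: PiE_iff)
      have "(\<Sum>i<Suc n. l i) - (\<Sum>i<n. a i) = (\<Sum>i<n. l i - a i) + l n"
        using sum_diff_distrib[of "{..<n}" a l] sum_mono[of "{..<n}" a l] le by simp
      also have "\<dots> = (\<Sum>i<Suc n. if i < n then l i - a i else l i)"
        by simp
      finally show ?thesis
        by (simp add: w_def power_sum prod.distrib power_add del: sum.lessThan_Suc prod.lessThan_Suc)
    qed
    then show "gt_sum x (Suc n) l * y ^ (\<Sum>i<Suc n. Suc (b i) - l i) =
        (\<Sum>a\<in>interlacing n l. gt_sum x n a * (\<Prod>i<Suc n. w a i (l i)))"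
      by (simp only: gt_sum.simps sum_distrib_right X_def[symmetric])
        (intro sum.cong refl, simp only: mult_ac)
  qed
  also have "\<dots> = (\<Sum>a\<in>C. \<Sum>l\<in>(\<Pi>\<^sub>E i\<in>{..<Suc n}. M a i). gt_sum x n a * (\<Prod>i<Suc n. w a i (l i)))"
    by (rule sum_swap_dependent[OF _ finC _ _ swapL])
      (auto intro!: finite_PiE simp: M_def)
  \<comment> \<open>With \<open>a\<close> fixed, the sum over the product set becomes a product over
    the rows.\<close>
  also have "\<dots> = (\<Sum>a\<in>C. gt_sum x n a * (\<Prod>i<Suc n. \<Sum>l\<in>M a i. w a i l))"
    by (simp only: sum_distrib_left[symmetric])
      (intro sum.cong refl arg_cong2[where f = "(*)"] prod_sum_PiE[symmetric], auto simp: M_def)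
  also have "\<dots> = (\<Sum>a\<in>C. gt_sum x n a *
      ((X + y) * X ^ b n * (\<Prod>i<n. \<Sum>k\<in>K a i. v a i k)))"
  proof (rule sum.cong[OF refl])
    fix a assume "a \<in> C"
    show "gt_sum x n a * (\<Prod>i<Suc n. \<Sum>l\<in>M a i. w a i l) =
        gt_sum x n a * ((X + y) * X ^ b n * (\<Prod>i<n. \<Sum>k\<in>K a i. v a i k))"
    \<comment> \<open>The row exchange requires \<open>a\<close> to be weakly decreasing; for any
      other \<open>a\<close> both sides vanish.\<close>
    proof (cases "antitone_below n a")
      case True
      have "(\<Sum>l\<in>M a i. w a i l) = add_factor X y (p a i) (b i) (a i)" if "i < n" for i
        using that by (simp add: M_def w_def add_factor_def)
      \<comment> \<open>The last row of \<open>l\<close> supplies the border factor with which the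
        telescoping ends.\<close>
      moreover have "(\<Sum>l\<in>M a n. w a n l) = X ^ b n * border_factor X y (p a n) (b n)"
        unfolding border_factor_def sum_distrib_left M_def w_def
        by (intro sum.cong) (auto simp: mult.assoc[symmetric] power_add[symmetric])
      moreover have "(\<Sum>k\<in>K a i. v a i k) = remove_factor X y (b i) (b (Suc i)) (a i)" for i
        by (simp add: K_def v_def remove_factor_def)
      ultimately show ?thesis
        using prod_factor_exchange[OF Suc.prems True, of X y]
        by (simp add: p_def mult_ac)
    qed (simp add: gt_sum_eq_0)
  qed
  \<comment> \<open>The product over the rows is expanded again, now into a sum over the smaller
    shape \<open>k\<close>.\<close>
  also have "\<dots> = (\<Sum>a\<in>C. \<Sum>k\<in>(\<Pi>\<^sub>E i\<in>{..<n}. K a i).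
      (X + y) * X ^ b n * gt_sum x n a * (\<Prod>i<n. v a i (k i)))"
    by (subst prod_sum_PiE) (auto simp: K_def sum_distrib_left mult_ac intro!: sum.cong)
  also have "\<dots> = (\<Sum>k\<in>interlacing n b. \<Sum>a\<in>(\<Pi>\<^sub>E i\<in>{..<n}. {k i..Suc (k i)}).
      (X + y) * X ^ b n * gt_sum x n a * (\<Prod>i<n. v a i (k i)))"
    by (rule sum_swap_dependent[OF _ finC _ _ swapR, symmetric])
      (auto intro!: finite_PiE simp: K_def)
  also have "\<dots> = (\<Sum>k\<in>interlacing n b. (X + y) * X ^ ((\<Sum>i<Suc n. b i) - (\<Sum>i<n. k i)) *
      (\<Sum>a\<in>(\<Pi>\<^sub>E i\<in>{..<n}. {k i..Suc (k i)}). gt_sum x n a * y ^ (\<Sum>i<n. Suc (k i) - a i)))"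
  proof (rule sum.cong[OF refl])
    fix k assume k: "k \<in> interlacing n b"
    then have le: "k i \<le> b i" if "i \<in> {..<n}" for i
      using that by (auto simp: PiE_iff)
    have "(\<Sum>i<Suc n. b i) - (\<Sum>i<n. k i) = b n + (\<Sum>i<n. b i - k i)"
      using sum_diff_distrib[of "{..<n}" k b] sum_mono[of "{..<n}" k b] le by simp
    then show "(\<Sum>a\<in>(\<Pi>\<^sub>E i\<in>{..<n}. {k i..Suc (k i)}).
          (X + y) * X ^ b n * gt_sum x n a * (\<Prod>i<n. v a i (k i))) =
        (X + y) * X ^ ((\<Sum>i<Suc n. b i) - (\<Sum>i<n. k i)) *
        (\<Sum>a\<in>(\<Pi>\<^sub>E i\<in>{..<n}. {k i..Suc (k i)}). gt_sum x n a * y ^ (\<Sum>i<n. Suc (k i) - a i))"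
      by (simp add: v_def prod.distrib power_add power_sum sum_distrib_left mult_ac
          del: sum.lessThan_Suc)
  qed
  \<comment> \<open>The inner sum over \<open>a\<close> is the left side of the induction hypothesis
    for \<open>k\<close>.\<close>
  also have "\<dots> = (\<Sum>k\<in>interlacing n b. (X + y) * X ^ ((\<Sum>i<Suc n. b i) - (\<Sum>i<n. k i)) *
      ((\<Prod>i<n. x (Suc i) + y) * gt_sum x n k))"
    by (intro sum.cong refl arg_cong2[where f = "(*)"] Suc.IH antitone_below_interlacing)
  also have "\<dots> = (\<Prod>i<Suc n. x (Suc i) + y) * gt_sum x (Suc n) b"
    by (simp add: X_def sum_distrib_left mult_ac del: sum.lessThan_Suc)
  finally show ?case .
qed

section \<open>Shapes in a rectangle and their duals\<close>

definition box_shapes :: "nat \<Rightarrow> nat \<Rightarrow> (nat \<Rightarrow> nat) set" where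
  "box_shapes n m = {f \<in> {..<n} \<rightarrow>\<^sub>E {..m}. antitone_below n f}"

text \<open>The conjugate of the complement of \<open>f\<close> in the rectangle with \<open>n\<close> rows of length \<open>m\<close>.\<close>

definition dual_shape :: "nat \<Rightarrow> nat \<Rightarrow> (nat \<Rightarrow> nat) \<Rightarrow> nat \<Rightarrow> nat" where
  "dual_shape n m f = (\<lambda>j\<in>{..<m}. card {i. i < n \<and> f i + j < m})"

lemma finite_box_shapes: "finite (box_shapes n m)"
  by (rule finite_subset[of _ "{..<n} \<rightarrow>\<^sub>E {..m}"]) (auto simp: box_shapes_def intro!: finite_PiE)

lemma box_shapes_le: "f \<in> box_shapes n m \<Longrightarrow> i < n \<Longrightarrow> f i \<le> m"
  by (auto simp: box_shapes_def PiE_iff)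

lemma dual_shape_in_box: "dual_shape n m f \<in> box_shapes m n"
proof -
  have "card {i. i < n \<and> f i + j < m} \<le> n" for j
    using card_mono[of "{..<n}" "{i. i < n \<and> f i + j < m}"] by auto
  then show ?thesis
    by (auto simp: box_shapes_def dual_shape_def antitone_below_def intro!: card_mono)
qed

text \<open>By monotonicity the rows counted in \<open>dual_shape n m f j\<close> form a final
  segment of \<open>{..<n}\<close>, and the left side says that row \<open>i\<close> lies before it.
  The involution and the interlacing criterion rest on this equivalence.\<close>

lemma dual_shape_less_iff:
  assumes "antitone_below n f" "i < n" "j < m"
  shows "i + dual_shape n m f j < n \<longleftrightarrow> m \<le> f i + j"
proof (cases "m \<le> f i + j")
  case True
  have "{k. k < n \<and> f k + j < m} \<subseteq> {i<..<n}"
    using True assms antitone_belowD[OF assms(1), of _ i] by (fastforce simp: not_le)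
  then have "card {k. k < n \<and> f k + j < m} \<le> card {i<..<n}"
    by (rule card_mono[rotated]) simp
  then show ?thesis using True assms by (simp add: dual_shape_def)
next
  case False
  have "{i..<n} \<subseteq> {k. k < n \<and> f k + j < m}"
    using False antitone_belowD[OF assms(1), of i] by fastforce
  then have "card {i..<n} \<le> card {k. k < n \<and> f k + j < m}"
    by (rule card_mono[rotated]) simp
  then show ?thesis using False assms by (simp add: dual_shape_def)
qed

text \<open>The twofold dual counts in row \<open>i\<close> the columns \<open>j < m\<close> with
  \<open>m \<le> f i + j\<close>, of which there are \<open>f i\<close>.\<close>

lemma dual_shape_dual_shape:
  assumes "f \<in> box_shapes n m"
  shows "dual_shape m n (dual_shape n m f) = f"
proof
  fix i
  show "dual_shape m n (dual_shape n m f) i = f i"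
  proof (cases "i < n")
    case True
    have anti: "antitone_below n f" and le: "f i \<le> m"
      using assms True by (auto simp: box_shapes_def PiE_iff)
    have "{j. j < m \<and> dual_shape n m f j + i < n} = {m - f i..<m}"
      using dual_shape_less_iff[OF anti True] le by (auto simp: add.commute)
    moreover have "dual_shape m n (dual_shape n m f) i =
        card {j. j < m \<and> dual_shape n m f j + i < n}"
      using True by (simp add: dual_shape_def[of m n])
    ultimately show ?thesis using le by simp
  next
    case False
    then show ?thesis using assms
      by (auto simp: box_shapes_def dual_shape_def PiE_iff extensional_def)
  qed
qed

text \<open>Double counting of the cells of the complement, by columns and by rows.\<close>

lemma sum_dual_shape:
  assumes "\<And>i. i < n \<Longrightarrow> f i \<le> m"
  shows "(\<Sum>j<m. dual_shape n m f j) = (\<Sum>i<n. m - f i)"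
proof -
  have "(\<Sum>j<m. dual_shape n m f j) = (\<Sum>j<m. \<Sum>i<n. if f i + j < m then 1 else 0)"
    by (auto simp: dual_shape_def sum.If_cases Int_def intro!: sum.cong)
  also have "\<dots> = (\<Sum>i<n. \<Sum>j<m. if f i + j < m then 1 else 0)"
    by (rule sum.swap)
  also have "\<dots> = (\<Sum>i<n. m - f i)"
  proof (rule sum.cong[OF refl])
    fix i
    have "{..<m} \<inter> {j. f i + j < m} = {..<m - f i}" by auto
    then show "(\<Sum>j<m. if f i + j < m then 1 else 0) = m - f i"
      by (simp add: sum.If_cases)
  qed
  finally show ?thesis .
qed

text \<open>Since the rectangle widens from \<open>m\<close> to \<open>Suc m\<close>, a row with
  \<open>f i = b i\<close> gives one cell of the horizontal strip between the duals, and a row with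
  \<open>f i = Suc (b i)\<close> gives none.\<close>

lemma dual_shape_interlacing_iff:
  assumes "f \<in> box_shapes n (Suc m)" "b \<in> box_shapes n m"
  shows "dual_shape n m b \<in> interlacing m (dual_shape n (Suc m) f) \<longleftrightarrow>
    (\<forall>i<n. b i \<le> f i \<and> f i \<le> Suc (b i))"
proof
  have f: "antitone_below n f" and b: "antitone_below n b"
    using assms by (auto simp: box_shapes_def)
  assume A: "dual_shape n m b \<in> interlacing m (dual_shape n (Suc m) f)"
  then have up: "dual_shape n m b j \<le> dual_shape n (Suc m) f j"
    and low: "dual_shape n (Suc m) f (Suc j) \<le> dual_shape n m b j" if "j < m" for j
    using that by (auto simp: PiE_iff)
  show "\<forall>i<n. b i \<le> f i \<and> f i \<le> Suc (b i)"
  proof (intro allI impI conjI)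
    fix i assume i: "i < n"
    have le: "f i \<le> Suc m" "b i \<le> m" using assms i by (auto intro: box_shapes_le)
    show "b i \<le> f i"
    proof (rule ccontr)
      \<comment> \<open>Column \<open>m - b i\<close> is the first in which the dual of
        \<open>b\<close> does not count row \<open>i\<close>, whereas the dual of \<open>f\<close>
        still counts row \<open>i\<close> in the column after it.\<close>
      assume "\<not> b i \<le> f i"
      then show False
        using low[of "m - b i"] le i dual_shape_less_iff[OF f i, of "Suc (m - b i)" "Suc m"]
          dual_shape_less_iff[OF b i, of "m - b i" m]
        by simp
    qed
    show "f i \<le> Suc (b i)"
    proof (rule ccontr)
      assume less: "\<not> f i \<le> Suc (b i)"
      \<comment> \<open>\<open>j\<close> is the last column in which the dual of \<open>b\<close>
        counts row \<open>i\<close>; the dual of \<open>f\<close> no longer counts it there.\<close>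
      then obtain j where "m = Suc (b i + j)"
        using le less_imp_Suc_add[of "b i" m] by auto
      then show False
        using less up[of j] i dual_shape_less_iff[OF f i, of j "Suc m"]
          dual_shape_less_iff[OF b i, of j m]
        by simp
    qed
  qed
next
  assume A: "\<forall>i<n. b i \<le> f i \<and> f i \<le> Suc (b i)"
  have "dual_shape n (Suc m) f (Suc j) \<le> dual_shape n m b j \<and>
      dual_shape n m b j \<le> dual_shape n (Suc m) f j" if "j < m" for j
    using that A by (fastforce simp: dual_shape_def intro!: card_mono)
  then show "dual_shape n m b \<in> interlacing m (dual_shape n (Suc m) f)"
    by (auto simp: PiE_iff dual_shape_def)
qed

section \<open>The dual Cauchy identity\<close>

text \<open>The branching rule for the dual shape, reindexed along the involution so that the sum
  runs over vertical strips in \<open>f\<close>. The exponent is the size of the removed horizontal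
  strip.\<close>

lemma gt_sum_dual_shape_Suc:
  fixes y :: "nat \<Rightarrow> 'a::comm_ring_1"
  assumes f: "f \<in> box_shapes n (Suc m)"
  shows "gt_sum y (Suc m) (dual_shape n (Suc m) f) =
    (\<Sum>b\<in>{b \<in> box_shapes n m. \<forall>i<n. b i \<le> f i \<and> f i \<le> Suc (b i)}.
      y (Suc m) ^ (\<Sum>i<n. Suc (b i) - f i) * gt_sum y m (dual_shape n m b))"
proof -
  let ?d = "dual_shape n (Suc m) f"
  have box: "g \<in> box_shapes m n" if g: "g \<in> interlacing m ?d" for g
  proof -
    have "g j \<le> n" if "j < m" for j
    proof -
      have "g j \<le> ?d j" using g that by (auto simp: PiE_iff)
      also have "\<dots> \<le> n" using that by (intro box_shapes_le[OF dual_shape_in_box]) simp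
      finally show ?thesis .
    qed
    then show ?thesis
      using g antitone_below_interlacing[OF g] by (auto simp: box_shapes_def PiE_iff)
  qed
  have "gt_sum y (Suc m) ?d =
    (\<Sum>g\<in>interlacing m ?d. y (Suc m) ^ ((\<Sum>j<Suc m. ?d j) - (\<Sum>j<m. g j)) * gt_sum y m g)"
    by (rule gt_sum.simps)
  also have "\<dots> = (\<Sum>b\<in>{b \<in> box_shapes n m. \<forall>i<n. b i \<le> f i \<and> f i \<le> Suc (b i)}.
      y (Suc m) ^ (\<Sum>i<n. Suc (b i) - f i) * gt_sum y m (dual_shape n m b))"
  proof (rule sum.reindex_bij_witness[where j = "dual_shape m n" and i = "dual_shape n m"])
    fix g assume g: "g \<in> interlacing m ?d"
    note b = dual_shape_in_box[of m n g]
    show gg: "dual_shape n m (dual_shape m n g) = g"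
      by (rule dual_shape_dual_shape[OF box[OF g]])
    then show mem: "dual_shape m n g \<in> {b \<in> box_shapes n m. \<forall>i<n. b i \<le> f i \<and> f i \<le> Suc (b i)}"
      using dual_shape_interlacing_iff[OF f b] b g by simp
    have "(\<Sum>j<Suc m. ?d j) = (\<Sum>i<n. Suc m - f i)"
      using f by (intro sum_dual_shape box_shapes_le)
    moreover have "(\<Sum>j<m. g j) = (\<Sum>i<n. m - dual_shape m n g i)"
      using sum_dual_shape[of n "dual_shape m n g" m] gg box_shapes_le[OF b] by simp
    \<comment> \<open>The truncated subtraction may be split row by row, because
      \<open>m - b i \<le> Suc m - f i\<close> for the shape \<open>b\<close> dual to
      \<open>g\<close>.\<close>
    moreover have "(\<Sum>i<n. Suc m - f i) - (\<Sum>i<n. m - dual_shape m n g i) =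
        (\<Sum>i<n. (Suc m - f i) - (m - dual_shape m n g i))"
      using mem box_shapes_le[OF b] by (intro sum_diff_distrib) fastforce
    moreover have "\<dots> = (\<Sum>i<n. Suc (dual_shape m n g i) - f i)"
      using mem box_shapes_le[OF b] box_shapes_le[OF f] by (intro sum.cong) fastforce+
    ultimately show "y (Suc m) ^ (\<Sum>i<n. Suc (dual_shape m n g i) - f i) *
          gt_sum y m (dual_shape n m (dual_shape m n g)) =
        y (Suc m) ^ ((\<Sum>j<Suc m. ?d j) - (\<Sum>j<m. g j)) * gt_sum y m g"
      using gg by simp
  next
    fix b assume b: "b \<in> {b \<in> box_shapes n m. \<forall>i<n. b i \<le> f i \<and> f i \<le> Suc (b i)}"
    then show "dual_shape m n (dual_shape n m b) = b"
      by (auto intro: dual_shape_dual_shape)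
    show "dual_shape n m b \<in> interlacing m ?d"
      using b dual_shape_interlacing_iff[OF f] by blast
  qed
  finally show ?thesis .
qed

lemma gt_sum_const_0: "gt_sum x n (\<lambda>_. 0) = 1"
proof (induction n)
  case (Suc n)
  have "gt_sum x n g = 1" if "g \<in> {..<n} \<rightarrow>\<^sub>E {0}" for g
  proof -
    have "gt_sum x n g = gt_sum x n (\<lambda>_. 0)"
      using that by (intro gt_sum_cong) (auto simp: PiE_iff)
    then show ?thesis using Suc by simp
  qed
  moreover have "card ({..<n} \<rightarrow>\<^sub>E {0::nat}) = 1" by (simp add: card_PiE)
  ultimately show ?case by simp
qed simp

text \<open>Stated for rectangles rather than squares because the induction changes only the width
  \<open>m\<close>.\<close>

theorem gt_sum_dual_cauchy:
  fixes x y :: "nat \<Rightarrow> 'a::comm_ring_1"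
  shows "(\<Sum>f\<in>box_shapes n m. gt_sum x n f * gt_sum y m (dual_shape n m f)) =
    (\<Prod>j<m. \<Prod>i<n. x (Suc i) + y (Suc j))"
proof (induction m)
  case 0
  have "box_shapes n 0 = {\<lambda>i\<in>{..<n}. 0}"
    by (auto simp: box_shapes_def antitone_below_def PiE_iff extensional_def fun_eq_iff)
  moreover have "gt_sum x n (\<lambda>i\<in>{..<n}. 0) = 1"
    using gt_sum_cong[of n "\<lambda>i\<in>{..<n}. 0" "\<lambda>_. 0" x] by (simp add: gt_sum_const_0)
  ultimately show ?case by (simp del: restrict_apply)
next
  case (Suc m)
  let ?R = "\<lambda>b f. \<forall>i<n. b i \<le> f i \<and> f i \<le> Suc (b i)"
  let ?w = "\<lambda>b f. y (Suc m) ^ (\<Sum>i<n. Suc (b i) - f i)"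
  have "(\<Sum>f\<in>box_shapes n (Suc m). gt_sum x n f * gt_sum y (Suc m) (dual_shape n (Suc m) f)) =
      (\<Sum>f\<in>box_shapes n (Suc m). \<Sum>b\<in>{b \<in> box_shapes n m. ?R b f}.
        gt_sum x n f * ?w b f * gt_sum y m (dual_shape n m b))"
    by (intro sum.cong refl) (simp only: gt_sum_dual_shape_Suc sum_distrib_left mult.assoc)
  also have "\<dots> = (\<Sum>b\<in>box_shapes n m. \<Sum>f\<in>{f \<in> box_shapes n (Suc m). ?R b f}.
        gt_sum x n f * ?w b f * gt_sum y m (dual_shape n m b))"
    by (rule sum.swap_restrict) (rule finite_box_shapes)+
  also have "\<dots> = (\<Sum>b\<in>box_shapes n m.
      (\<Prod>i<n. x (Suc i) + y (Suc m)) * (gt_sum x n b * gt_sum y m (dual_shape n m b)))"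
  proof (rule sum.cong[OF refl])
    fix b assume b: "b \<in> box_shapes n m"
    have "{f \<in> box_shapes n (Suc m). ?R b f} \<subseteq> (\<Pi>\<^sub>E i\<in>{..<n}. {b i..Suc (b i)})"
      by (rule subsetI) (simp add: box_shapes_def PiE_iff)
    \<comment> \<open>The Pieri rule sums over the whole product set; the functions added here are
      not weakly decreasing and contribute 0.\<close>
    moreover have "gt_sum x n f = 0"
      if "f \<in> (\<Pi>\<^sub>E i\<in>{..<n}. {b i..Suc (b i)}) - {f \<in> box_shapes n (Suc m). ?R b f}" for f
    proof (rule gt_sum_eq_0)
      from that have f: "f \<in> extensional {..<n}" "?R b f" "f \<notin> box_shapes n (Suc m)"
        by (auto simp: PiE_iff)
      have "f i \<le> Suc m" if "i < n" for i
        using f(2) box_shapes_le[OF b that] that by fastforce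
      then show "\<not> antitone_below n f"
        using f by (simp add: box_shapes_def PiE_iff)
    qed
    ultimately have "(\<Sum>f\<in>{f \<in> box_shapes n (Suc m). ?R b f}. gt_sum x n f * ?w b f) =
        (\<Sum>f\<in>(\<Pi>\<^sub>E i\<in>{..<n}. {b i..Suc (b i)}). gt_sum x n f * ?w b f)"
      by (intro sum.mono_neutral_left) (auto intro!: finite_PiE)
    also have "\<dots> = (\<Prod>i<n. x (Suc i) + y (Suc m)) * gt_sum x n b"
      using b by (intro gt_sum_pieri) (simp add: box_shapes_def)
    finally show "(\<Sum>f\<in>{f \<in> box_shapes n (Suc m). ?R b f}.
          gt_sum x n f * ?w b f * gt_sum y m (dual_shape n m b)) =
        (\<Prod>i<n. x (Suc i) + y (Suc m)) * (gt_sum x n b * gt_sum y m (dual_shape n m b))"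
      by (simp only: sum_distrib_right[symmetric] mult.assoc[symmetric])
  qed
  also have "\<dots> = (\<Prod>j<Suc m. \<Prod>i<n. x (Suc i) + y (Suc j))"
    by (simp add: sum_distrib_left[symmetric] Suc.IH mult.commute)
  finally show ?case .
qed

section \<open>Semistandard tableaux and the branching rule\<close>

definition cells :: "nat \<Rightarrow> (nat \<Rightarrow> nat) \<Rightarrow> (nat \<times> nat) set" where
  "cells n f = {(i, j). i < n \<and> j < f i}"

lemma cells_Sigma: "cells n f = (SIGMA i:{..<n}. {..<f i})"
  by (auto simp: cells_def)

lemma finite_cells: "finite (cells n f)"
  by (simp add: cells_Sigma)

lemma card_cells: "card (cells n f) = (\<Sum>i<n. f i)"
  by (simp add: cells_Sigma)

text \<open>The conditions of \<open>tableaux\<close> for an arbitrary set of cells, so that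
  branching can work with shapes given by functions.\<close>

definition ssyt :: "nat \<Rightarrow> (nat \<times> nat) set \<Rightarrow> (nat \<times> nat \<Rightarrow> nat) set" where
  "ssyt n D = {T \<in> D \<rightarrow>\<^sub>E {1..n}.
     (\<forall>i j j'. (i, j) \<in> D \<and> (i, j') \<in> D \<and> j < j' \<longrightarrow> T (i, j) \<le> T (i, j')) \<and>
     (\<forall>i i' j. (i, j) \<in> D \<and> (i', j) \<in> D \<and> i < i' \<longrightarrow> T (i, j) < T (i', j))}"

lemma ssyt_row:
  "T \<in> ssyt n D \<Longrightarrow> (i, j) \<in> D \<Longrightarrow> (i, j') \<in> D \<Longrightarrow> j < j' \<Longrightarrow> T (i, j) \<le> T (i, j')"
  by (simp add: ssyt_def)

lemma ssyt_col:
  "T \<in> ssyt n D \<Longrightarrow> (i, j) \<in> D \<Longrightarrow> (i', j) \<in> D \<Longrightarrow> i < i' \<Longrightarrow> T (i, j) < T (i', j)"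
  by (simp add: ssyt_def)

lemma ssyt_range: "T \<in> ssyt n D \<Longrightarrow> c \<in> D \<Longrightarrow> 1 \<le> T c \<and> T c \<le> n"
  by (auto simp: ssyt_def PiE_iff)

lemma finite_ssyt: "finite D \<Longrightarrow> finite (ssyt n D)"
  by (rule finite_subset[of _ "D \<rightarrow>\<^sub>E {1..n}"]) (simp_all add: ssyt_def finite_PiE subset_eq)

lemma down_closed_eq_lessThan_card:
  fixes A :: "nat set"
  assumes "finite A" "\<And>i j. i < j \<Longrightarrow> j \<in> A \<Longrightarrow> i \<in> A"
  shows "A = {..<card A}"
proof -
  define k where "k = (LEAST k. k \<notin> A)"
  have "k \<notin> A"
    unfolding k_def using ex_new_if_finite[OF infinite_UNIV_nat assms(1)] by (rule LeastI_ex)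
  moreover have "i \<in> A" if "i < k" for i
    using not_less_Least[of i "\<lambda>k. k \<notin> A"] that unfolding k_def by simp
  moreover have "i < k" if "i \<in> A" for i
    using that assms(2)[of k i] \<open>k \<notin> A\<close> by (metis linorder_neqE_nat)
  ultimately have "A = {..<k}" by blast
  then show ?thesis by simp
qed

text \<open>Columns start with an entry of at least 1 and increase strictly, while rows are counted
  from 0.\<close>

lemma ssyt_entry_gt_row:
  assumes "T \<in> ssyt n (cells m f)" "antitone_below m f" "(i, j) \<in> cells m f"
  shows "i < T (i, j)"
  using assms(3)
proof (induction i)
  case 0
  then show ?case using ssyt_range[OF assms(1)] by fastforce
next
  case (Suc i)
  then have "f (Suc i) \<le> f i"
    by (intro antitone_belowD[OF assms(2)]) (auto simp: cells_def)
  then have "(i, j) \<in> cells m f" using Suc.prems by (auto simp: cells_def)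
  then show ?case using Suc ssyt_col[OF assms(1), of i j "Suc i"] by simp
qed

text \<open>In a tableau with entries up to \<open>Suc n\<close>, the row with index
  \<open>n\<close> contains only \<open>Suc n\<close>, so \<open>n\<close> rows suffice.\<close>

definition lower_shape :: "nat \<Rightarrow> (nat \<Rightarrow> nat) \<Rightarrow> (nat \<times> nat \<Rightarrow> nat) \<Rightarrow> nat \<Rightarrow> nat" where
  "lower_shape n f T = (\<lambda>i\<in>{..<n}. card {j. j < f i \<and> T (i, j) \<le> n})"

text \<open>Inverse to cutting a tableau down to its \<open>lower_shape\<close>.\<close>

definition fill_up :: "nat \<Rightarrow> (nat \<Rightarrow> nat) \<Rightarrow> (nat \<Rightarrow> nat) \<Rightarrow> (nat \<times> nat \<Rightarrow> nat) \<Rightarrow> nat \<times> nat \<Rightarrow> nat"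
  where "fill_up n f g T = (\<lambda>c\<in>cells (Suc n) f. if c \<in> cells n g then T c else Suc n)"

context
  fixes n :: nat and f :: "nat \<Rightarrow> nat"
  assumes anti: "antitone_below (Suc n) f"
begin

text \<open>Rows increase weakly, so the entries at most \<open>n\<close> form an initial segment of
  each row.\<close>

lemma entry_le_iff:
  assumes T: "T \<in> ssyt (Suc n) (cells (Suc n) f)" and c: "c \<in> cells (Suc n) f"
  shows "T c \<le> n \<longleftrightarrow> c \<in> cells n (lower_shape n f T)"
proof -
  obtain i j where ij: "c = (i, j)" "i < Suc n" "j < f i"
    using c by (auto simp: cells_def)
  show ?thesis
  proof (cases "i < n")
    case True
    let ?A = "{j. j < f i \<and> T (i, j) \<le> n}"
    have "?A = {..<card ?A}"
    proof (rule down_closed_eq_lessThan_card)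
      fix k l assume kl: "k < l" "l \<in> ?A"
      then have "T (i, k) \<le> T (i, l)"
        using True by (intro ssyt_row[OF T]) (auto simp: cells_def)
      then show "k \<in> ?A" using kl by auto
    qed simp
    then have "j \<in> ?A \<longleftrightarrow> j < card ?A" by blast
    then show ?thesis
      using True ij by (simp add: cells_def lower_shape_def)
  next
    case False
    then show ?thesis
      using ssyt_entry_gt_row[OF T anti, of i j] ij by (simp add: cells_def)
  qed
qed

text \<open>The lower bound holds because \<open>Suc n\<close> can stand only at the bottom of a
  column.\<close>

lemma lower_shape_interlacing:
  assumes T: "T \<in> ssyt (Suc n) (cells (Suc n) f)"
  shows "lower_shape n f T \<in> interlacing n f"
proof -
  let ?g = "lower_shape n f T"
  have "f (Suc i) \<le> ?g i \<and> ?g i \<le> f i" if i: "i < n" for i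
  proof
    show "?g i \<le> f i"
      using i card_mono[of "{..<f i}" "{j. j < f i \<and> T (i, j) \<le> n}"]
      by (auto simp: lower_shape_def)
    show "f (Suc i) \<le> ?g i"
    proof (rule ccontr)
      assume "\<not> f (Suc i) \<le> ?g i"
      then have "(Suc i, ?g i) \<in> cells (Suc n) f" "(i, ?g i) \<in> cells (Suc n) f"
        using i antitone_belowD[OF anti, of i "Suc i"] by (auto simp: cells_def)
      moreover from this have "T (i, ?g i) < T (Suc i, ?g i)"
        using ssyt_col[OF T] by simp
      ultimately show False
        using ssyt_range[OF T, of "(Suc i, ?g i)"] entry_le_iff[OF T, of "(i, ?g i)"]
        by (auto simp: cells_def)
    qed
  qed
  then show ?thesis by (auto simp: PiE_iff lower_shape_def)
qed

lemma cells_interlacing: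
  assumes "g \<in> interlacing n f"
  shows "cells n g \<subseteq> cells (Suc n) f"
proof -
  have "g i \<le> f i" if "i < n" for i
    using assms that by (auto simp: PiE_iff)
  then show ?thesis by (fastforce simp: cells_def)
qed

lemma restrict_lower_shape_ssyt:
  assumes T: "T \<in> ssyt (Suc n) (cells (Suc n) f)"
  shows "restrict T (cells n (lower_shape n f T)) \<in> ssyt n (cells n (lower_shape n f T))"
proof -
  let ?D = "cells n (lower_shape n f T)"
  have sub: "c \<in> cells (Suc n) f" if "c \<in> ?D" for c
    using cells_interlacing[OF lower_shape_interlacing[OF T]] that by blast
  have "1 \<le> T c \<and> T c \<le> n" if "c \<in> ?D" for c
    using that ssyt_range[OF T, of c] entry_le_iff[OF T, of c] sub[OF that] by simp
  then have "restrict T ?D \<in> ?D \<rightarrow>\<^sub>E {1..n}"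
    by (simp add: PiE_iff)
  then show ?thesis
    using ssyt_row[OF T] ssyt_col[OF T] sub by (simp add: ssyt_def)
qed

lemma fill_up_ssyt:
  assumes g: "g \<in> interlacing n f" and T: "T \<in> ssyt n (cells n g)"
  shows "fill_up n f g T \<in> ssyt (Suc n) (cells (Suc n) f)"
proof -
  let ?T = "fill_up n f g T" and ?D = "cells (Suc n) f"
  have "1 \<le> ?T c \<and> ?T c \<le> Suc n" if "c \<in> ?D" for c
    using that ssyt_range[OF T, of c] by (auto simp: fill_up_def)
  moreover have "?T (i, j) \<le> ?T (i, j')" if "(i, j) \<in> ?D" "(i, j') \<in> ?D" "j < j'" for i j j'
  proof (cases "(i, j') \<in> cells n g")
    case True
    then have "(i, j) \<in> cells n g" using that by (auto simp: cells_def)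
    then show ?thesis using True that ssyt_row[OF T] by (simp add: fill_up_def)
  next
    case False
    then show ?thesis using that ssyt_range[OF T, of "(i, j)"] by (auto simp: fill_up_def)
  qed
  moreover have "?T (i, j) < ?T (i', j)" if "(i, j) \<in> ?D" "(i', j) \<in> ?D" "i < i'" for i i' j
  proof -
    \<comment> \<open>Since \<open>f (Suc i) \<le> g i\<close>, only the bottom cell of a column can
      lie outside \<open>g\<close>.\<close>
    have "f i' \<le> f (Suc i)" "i < n"
      using that antitone_belowD[OF anti, of "Suc i" i'] by (auto simp: cells_def)
    moreover from \<open>i < n\<close> have "f (Suc i) \<le> g i" using g by (auto simp: PiE_iff)
    ultimately have D: "(i, j) \<in> cells n g" using that by (auto simp: cells_def)
    then show ?thesis
      using that ssyt_range[OF T D] ssyt_col[OF T D, of i'] by (auto simp: fill_up_def)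
  qed
  moreover have "?T \<in> extensional ?D" by (simp add: fill_up_def)
  ultimately show ?thesis by (simp add: ssyt_def PiE_iff)
qed

lemma lower_shape_fill_up:
  assumes g: "g \<in> interlacing n f" and T: "T \<in> ssyt n (cells n g)"
  shows "lower_shape n f (fill_up n f g T) = g"
proof
  fix i
  show "lower_shape n f (fill_up n f g T) i = g i"
  proof (cases "i < n")
    case True
    then have "g i \<le> f i" using g by (auto simp: PiE_iff)
    then have "{j. j < f i \<and> fill_up n f g T (i, j) \<le> n} = {..<g i}"
      using True ssyt_range[OF T] by (auto simp: fill_up_def cells_def split: if_splits)
    then show ?thesis using True by (simp add: lower_shape_def)
  next
    case False
    then show ?thesis using g by (auto simp: lower_shape_def PiE_iff extensional_def)
  qed
qed

text \<open>Tableaux of shape \<open>f\<close> correspond to pairs of an interlacing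
  \<open>g\<close> and a tableau of shape \<open>g\<close>. The cells between the two shapes all
  carry \<open>Suc n\<close>, which gives the power of \<open>x (Suc n)\<close>.\<close>

lemma ssyt_branching:
  fixes x :: "nat \<Rightarrow> 'a::comm_ring_1"
  shows "(\<Sum>T\<in>ssyt (Suc n) (cells (Suc n) f). \<Prod>c\<in>cells (Suc n) f. x (T c)) =
    (\<Sum>g\<in>interlacing n f. x (Suc n) ^ ((\<Sum>i<Suc n. f i) - (\<Sum>i<n. g i)) *
      (\<Sum>T\<in>ssyt n (cells n g). \<Prod>c\<in>cells n g. x (T c)))"
proof -
  let ?D = "cells (Suc n) f"
  let ?e = "\<lambda>g. (\<Sum>i<Suc n. f i) - (\<Sum>i<n. g i)"
  have "(\<Sum>T\<in>ssyt (Suc n) ?D. \<Prod>c\<in>?D. x (T c)) =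
      (\<Sum>(g, T)\<in>(SIGMA g:interlacing n f. ssyt n (cells n g)).
        x (Suc n) ^ ?e g * (\<Prod>c\<in>cells n g. x (T c)))"
  proof (rule sum.reindex_bij_witness
      [where j = "\<lambda>T. (lower_shape n f T, restrict T (cells n (lower_shape n f T)))"
         and i = "\<lambda>(g, T). fill_up n f g T"])
    fix T assume T: "T \<in> ssyt (Suc n) ?D"
    let ?g = "lower_shape n f T"
    note g = lower_shape_interlacing[OF T]
    show "(?g, restrict T (cells n ?g)) \<in> (SIGMA g:interlacing n f. ssyt n (cells n g))"
      using g restrict_lower_shape_ssyt[OF T] by blast
    have top: "T c = Suc n" if "c \<in> ?D - cells n ?g" for c
      using that ssyt_range[OF T, of c] entry_le_iff[OF T, of c] by force
    have "T c = undefined" if "c \<notin> ?D" for c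
      using T that by (auto simp: ssyt_def intro: PiE_arb)
    with top show "(case (?g, restrict T (cells n ?g)) of (g, T) \<Rightarrow> fill_up n f g T) = T"
      by (simp add: fill_up_def fun_eq_iff del: split_paired_All)
    have "(\<Prod>c\<in>?D. x (T c)) = (\<Prod>c\<in>?D - cells n ?g. x (T c)) * (\<Prod>c\<in>cells n ?g. x (T c))"
      using cells_interlacing[OF g] by (intro prod.subset_diff finite_cells)
    also have "(\<Prod>c\<in>?D - cells n ?g. x (T c)) = x (Suc n) ^ card (?D - cells n ?g)"
      using top by simp
    also have "card (?D - cells n ?g) = ?e ?g"
      using cells_interlacing[OF g] by (simp only: card_Diff_subset finite_cells card_cells)
    finally show "(case (?g, restrict T (cells n ?g)) of (g, T) \<Rightarrow>
        x (Suc n) ^ ?e g * (\<Prod>c\<in>cells n g. x (T c))) = (\<Prod>c\<in>?D. x (T c))"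
      by simp
  next
    fix gT assume "gT \<in> (SIGMA g:interlacing n f. ssyt n (cells n g))"
    then obtain g T where gT: "gT = (g, T)" and g: "g \<in> interlacing n f"
      and T: "T \<in> ssyt n (cells n g)" by blast
    show "(case gT of (g, T) \<Rightarrow> fill_up n f g T) \<in> ssyt (Suc n) ?D"
      using fill_up_ssyt[OF g T] gT by simp
    have "undefined = T c" if "c \<notin> cells n g" for c
      using T that by (auto simp: ssyt_def intro: PiE_arb[symmetric])
    moreover have "c \<in> ?D" if "c \<in> cells n g" for c
      using that cells_interlacing[OF g] by blast
    ultimately have "restrict (fill_up n f g T) (cells n g) = T"
      by (intro ext) (simp add: fill_up_def restrict_def)
    then show "(lower_shape n f (case gT of (g, T) \<Rightarrow> fill_up n f g T),
        restrict (case gT of (g, T) \<Rightarrow> fill_up n f g T)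
          (cells n (lower_shape n f (case gT of (g, T) \<Rightarrow> fill_up n f g T)))) = gT"
      using lower_shape_fill_up[OF g T] gT by simp
  qed
  also have "\<dots> = (\<Sum>g\<in>interlacing n f. \<Sum>T\<in>ssyt n (cells n g).
      x (Suc n) ^ ?e g * (\<Prod>c\<in>cells n g. x (T c)))"
    by (intro sum.Sigma[symmetric] finite_interlacing ballI finite_ssyt finite_cells)
  finally show ?thesis by (simp only: sum_distrib_left)
qed

end

lemma sum_ssyt_eq_gt_sum:
  fixes x :: "nat \<Rightarrow> 'a::comm_ring_1"
  assumes "antitone_below n f"
  shows "(\<Sum>T\<in>ssyt n (cells n f). \<Prod>c\<in>cells n f. x (T c)) = gt_sum x n f"
  using assms
proof (induction n arbitrary: f)
  case 0
  have "ssyt 0 (cells 0 f) = {\<lambda>_. undefined}" by (auto simp: ssyt_def cells_def)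
  then show ?case by (simp add: cells_def)
next
  case (Suc n)
  show ?case
    unfolding ssyt_branching[OF Suc.prems] gt_sum.simps
    by (intro sum.cong refl arg_cong2[where f = "(*)"] Suc.IH antitone_below_interlacing)
qed

lemma schur_eq_gt_sum:
  assumes "length \<mu> \<le> n" "antitone_below n (row_length \<mu>)"
  shows "schur n \<mu> x = gt_sum x n (row_length \<mu>)"
proof -
  have "diagram \<mu> = cells n (row_length \<mu>)"
    using assms(1) by (auto simp: diagram_def cells_def row_length_def split: if_splits)
  moreover have "tableaux n \<mu> = ssyt n (diagram \<mu>)"
    by (simp add: tableaux_def ssyt_def)
  ultimately show ?thesis
    using sum_ssyt_eq_gt_sum[OF assms(2), of x] by (simp add: schur_def)
qed

section \<open>Partitions as lists and as functions of the row index\<close>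

lemma antitone_below_row_length:
  assumes "sorted_wrt (\<ge>) \<mu>"
  shows "antitone_below n (row_length \<mu>)"
  using sorted_wrt_nth_less[OF assms]
  by (auto simp: antitone_below_def row_length_def le_less)

lemma partition_eq_map_row_length:
  assumes "is_partition \<mu>" "length \<mu> \<le> r"
  shows "\<mu> = filter (\<lambda>p. 0 < p) (map (row_length \<mu>) [0..<r])"
proof -
  have "[0..<r] = [0..<length \<mu>] @ [length \<mu>..<r]"
    using assms(2) by (metis le_add_diff_inverse upt_add_eq_append zero_le)
  moreover have "map (row_length \<mu>) [0..<length \<mu>] = \<mu>"
    by (rule nth_equalityI) (simp_all add: row_length_def)
  moreover have "filter (\<lambda>p. 0 < p) \<mu> = \<mu>"
    using assms(1) by (intro filter_True ballI gr0I) (auto simp: is_partition_def)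
  moreover have "filter (\<lambda>p. 0 < p) (map (row_length \<mu>) [length \<mu>..<r]) = []"
    by (rule filter_False) (simp add: row_length_def)
  ultimately show ?thesis by simp
qed

text \<open>Lists without zeros index the sum in \<open>F\<close>, functions padded with zeros the
  dual Cauchy identity.\<close>

lemma bij_betw_partitions_in_box:
  "bij_betw (\<lambda>\<mu>. restrict (row_length \<mu>) {..<r}) (partitions_in_box r c) (box_shapes r c)"
proof (rule bij_betw_imageI)
  show "inj_on (\<lambda>\<mu>. restrict (row_length \<mu>) {..<r}) (partitions_in_box r c)"
  proof (rule inj_onI)
    fix \<mu> \<nu> assume \<mu>: "\<mu> \<in> partitions_in_box r c" and \<nu>: "\<nu> \<in> partitions_in_box r c"
      and eq: "restrict (row_length \<mu>) {..<r} = restrict (row_length \<nu>) {..<r}"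
    have "row_length \<mu> i = row_length \<nu> i" if "i < r" for i
      using fun_cong[OF eq, of i] that by simp
    then have map_eq: "map (row_length \<mu>) [0..<r] = map (row_length \<nu>) [0..<r]" by simp
    have "\<mu> = filter (\<lambda>p. 0 < p) (map (row_length \<mu>) [0..<r])"
      using \<mu> by (intro partition_eq_map_row_length) (auto simp: partitions_in_box_def)
    also note map_eq
    also have "filter (\<lambda>p. 0 < p) (map (row_length \<nu>) [0..<r]) = \<nu>"
      using \<nu> by (intro partition_eq_map_row_length[symmetric]) (auto simp: partitions_in_box_def)
    finally show "\<mu> = \<nu>" .
  qed
  show "(\<lambda>\<mu>. restrict (row_length \<mu>) {..<r}) ` partitions_in_box r c = box_shapes r c"
  proof (intro equalityI subsetI)
    fix f assume "f \<in> (\<lambda>\<mu>. restrict (row_length \<mu>) {..<r}) ` partitions_in_box r c"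
    then obtain \<mu> where \<mu>: "\<mu> \<in> partitions_in_box r c" and f: "f = restrict (row_length \<mu>) {..<r}"
      by (rule imageE)
    have "row_length \<mu> i \<le> c" for i
      using \<mu> by (simp add: partitions_in_box_def row_length_def)
    moreover have "antitone_below r (row_length \<mu>)"
      using \<mu> by (intro antitone_below_row_length) (simp add: partitions_in_box_def is_partition_def)
    ultimately show "f \<in> box_shapes r c"
      by (simp add: f box_shapes_def antitone_below_def)
  next
    fix f assume f: "f \<in> box_shapes r c"
    then have anti: "antitone_below r f" and ext: "f \<in> extensional {..<r}"
      by (auto simp: box_shapes_def PiE_iff)
    \<comment> \<open>The number of nonzero rows. These come first, so cutting \<open>f\<close> off
      at \<open>k\<close> yields the preimage.\<close>
    define k where "k = card {i. i < r \<and> 0 < f i}"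
    have k: "{i. i < r \<and> 0 < f i} = {..<k}"
      unfolding k_def
    proof (rule down_closed_eq_lessThan_card)
      fix i j assume "i < j" "j \<in> {i. i < r \<and> 0 < f i}"
      then show "i \<in> {i. i < r \<and> 0 < f i}"
        using antitone_belowD[OF anti, of i j] by simp
    qed simp
    have k_iff: "i < k \<longleftrightarrow> i < r \<and> 0 < f i" for i
      using eqset_imp_iff[OF k, of i] by simp
    then have pos: "i < r" "0 < f i" if "i < k" for i
      using that by simp_all
    have "k \<le> r" using pos(1)[of r] by (cases "r < k") simp_all
    let ?\<mu> = "map f [0..<k]"
    have "f j \<le> f i" if "i < j" "j < k" for i j
      using that \<open>k \<le> r\<close> by (intro antitone_belowD[OF anti]) simp_all
    then have "sorted_wrt (\<ge>) ?\<mu>"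
      by (simp add: sorted_wrt_iff_nth_less)
    moreover have "0 < p" "p \<le> c" if "p \<in> set ?\<mu>" for p
      using that pos box_shapes_le[OF f] by auto
    ultimately have "?\<mu> \<in> partitions_in_box r c"
      using \<open>k \<le> r\<close> by (force simp: partitions_in_box_def is_partition_def)
    moreover have "restrict (row_length ?\<mu>) {..<r} = f"
    proof
      fix i
      have "f i = 0" if "i < r" "\<not> i < k" using that k_iff by simp
      moreover have "f i = undefined" if "\<not> i < r"
        using that by (intro extensional_arb[OF ext]) simp
      ultimately show "restrict (row_length ?\<mu>) {..<r} i = f i"
        by (simp add: row_length_def)
    qed
    ultimately show "f \<in> (\<lambda>\<mu>. restrict (row_length \<mu>) {..<r}) ` partitions_in_box r c"
      by (metis (no_types, lifting) image_eqI)
  qed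
qed

lemma row_length_conjugate:
  assumes "sorted_wrt (\<ge>) \<nu>"
  shows "row_length (conjugate \<nu>) j = length (filter (\<lambda>p. j < p) \<nu>)"
proof (cases "j < row_length \<nu> 0")
  case True
  then show ?thesis
    by (simp add: conjugate_def row_length_def[of "map _ _"] diagram_def length_filter_conv_card)
next
  case False
  have "p \<le> row_length \<nu> 0" if "p \<in> set \<nu>" for p
    using that assms by (cases \<nu>) (auto simp: row_length_def)
  then have "filter (\<lambda>p. j < p) \<nu> = []"
    using False by (intro filter_False) fastforce
  then show ?thesis
    using False by (simp add: conjugate_def row_length_def[of "map _ _"])
qed

text \<open>The zeros dropped before conjugation have no effect, because a part counts in column
  \<open>j\<close> only if it exceeds \<open>j\<close>.\<close>

lemma
  assumes "sorted_wrt (\<ge>) \<mu>"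
  shows row_length_complementary:
      "j < N \<Longrightarrow> row_length (complementary N \<mu>) j = dual_shape N N (row_length \<mu>) j"
    and length_complementary: "length (complementary N \<mu>) \<le> N"
proof -
  define L where "L = map (\<lambda>i. N - row_length \<mu> i) (rev [0..<N])"
  let ?\<nu> = "filter (\<lambda>p. 0 < p) L"
  have compl: "complementary N \<mu> = conjugate ?\<nu>"
    by (simp add: complementary_def L_def)
  have "row_length \<mu> j \<le> row_length \<mu> i" if "i \<le> j" for i j
    using antitone_belowD[OF antitone_below_row_length[OF assms], of i j "Suc j"] that by simp
  then have "sorted_wrt (\<ge>) L"
    by (auto simp: L_def sorted_wrt_iff_nth_less rev_nth intro!: diff_le_mono2)
  then have sorted: "sorted_wrt (\<ge>) ?\<nu>"
    by (rule sorted_wrt_filter)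
  have "\<forall>p\<in>set ?\<nu>. p \<le> N" by (auto simp: L_def)
  then have "row_length ?\<nu> 0 \<le> N"
    by (metis row_length_def nth_mem zero_le)
  then show "length (complementary N \<mu>) \<le> N"
    by (simp add: compl conjugate_def)
  assume "j < N"
  have "row_length (conjugate ?\<nu>) j = length (filter (\<lambda>p. j < p) ?\<nu>)"
    by (rule row_length_conjugate[OF sorted])
  also have "filter (\<lambda>p. j < p) ?\<nu> = filter (\<lambda>p. j < p) L"
    by (auto intro!: filter_cong)
  also have "length \<dots> = length (filter (\<lambda>i. j < N - row_length \<mu> i) [0..<N])"
    by (simp add: L_def filter_map rev_filter[symmetric] o_def)
  also have "\<dots> = card {i. i < N \<and> row_length \<mu> i + j < N}"
    by (auto simp: length_filter_conv_card intro!: arg_cong[of _ _ card])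
  finally show "row_length (complementary N \<mu>) j = dual_shape N N (row_length \<mu>) j"
    using \<open>j < N\<close> by (simp add: compl dual_shape_def)
qed

lemma schur_complementary:
  assumes "sorted_wrt (\<ge>) \<mu>"
  shows "schur N (complementary N \<mu>) x = gt_sum x N (dual_shape N N (row_length \<mu>))"
proof -
  note eq = row_length_complementary[OF assms, of _ N]
  have "antitone_below N (row_length (complementary N \<mu>))"
    using dual_shape_in_box[of N N "row_length \<mu>"] eq
    by (simp add: box_shapes_def antitone_below_def)
  then have "schur N (complementary N \<mu>) x = gt_sum x N (row_length (complementary N \<mu>))"
    by (intro schur_eq_gt_sum length_complementary assms)
  also have "\<dots> = gt_sum x N (dual_shape N N (row_length \<mu>))"
    by (intro gt_sum_cong eq)
  finally show ?thesis .
qed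

section \<open>Combining both halves of the square\<close>

text \<open>Prepending \<open>N\<close> maps the partitions indexing \<open>F\<close> bijectively
  onto those in the square whose first row is full.\<close>

lemma F_eq_sum_gt_sum:
  assumes "N \<ge> 1"
  shows "F N \<chi> \<delta> = (\<Sum>f\<in>{f \<in> box_shapes N N. f 0 = N}. gt_sum \<delta> N f * gt_sum \<chi> N (dual_shape N N f))"
proof -
  let ?P = "{\<mu> \<in> partitions_in_box N N. row_length \<mu> 0 = N}"
  let ?r = "\<lambda>\<mu>. restrict (row_length \<mu>) {..<N}"
  have "F N \<chi> \<delta> = (\<Sum>\<mu>\<in>?P. schur N \<mu> \<delta> * schur N (complementary N \<mu>) \<chi>)"
    unfolding F_def
  proof (rule sum.reindex_bij_witness[where j = "\<lambda>\<mu>. N # \<mu>" and i = tl])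
    fix \<mu> assume "\<mu> \<in> ?P"
    then obtain \<kappa> where "\<mu> = N # \<kappa>"
      using assms by (cases \<mu>) (auto simp: row_length_def)
    then show "N # tl \<mu> = \<mu>" "tl \<mu> \<in> partitions_in_box (N - 1) N"
      using \<open>\<mu> \<in> ?P\<close> by (auto simp: partitions_in_box_def is_partition_def)
  qed (use assms in \<open>auto simp: partitions_in_box_def is_partition_def row_length_def\<close>)
  also have "\<dots> = (\<Sum>\<mu>\<in>?P. gt_sum \<delta> N (?r \<mu>) * gt_sum \<chi> N (dual_shape N N (?r \<mu>)))"
  proof (rule sum.cong[OF refl])
    fix \<mu> assume \<mu>: "\<mu> \<in> ?P"
    then have sorted: "sorted_wrt (\<ge>) \<mu>" and len: "length \<mu> \<le> N"
      by (auto simp: partitions_in_box_def is_partition_def)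
    have "schur N \<mu> \<delta> = gt_sum \<delta> N (?r \<mu>)"
      using schur_eq_gt_sum[OF len antitone_below_row_length[OF sorted], of \<delta>]
        gt_sum_cong[of N "row_length \<mu>" "?r \<mu>" \<delta>] by simp
    moreover have "dual_shape N N (?r \<mu>) = dual_shape N N (row_length \<mu>)"
      by (auto simp: dual_shape_def intro!: restrict_ext arg_cong[of _ _ card])
    ultimately show "schur N \<mu> \<delta> * schur N (complementary N \<mu>) \<chi> =
        gt_sum \<delta> N (?r \<mu>) * gt_sum \<chi> N (dual_shape N N (?r \<mu>))"
      by (simp only: schur_complementary[OF sorted])
  qed
  also have "\<dots> = (\<Sum>f\<in>{f \<in> box_shapes N N. f 0 = N}. gt_sum \<delta> N f * gt_sum \<chi> N (dual_shape N N f))"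
  proof (rule sum.reindex_bij_betw)
    have "?r \<mu> 0 = row_length \<mu> 0" for \<mu>
      using assms by simp
    then have "?r ` ?P = ?r ` {\<mu> \<in> partitions_in_box N N. ?r \<mu> 0 = N}"
      by (simp only:)
    also have "\<dots> = {f \<in> ?r ` partitions_in_box N N. f 0 = N}"
      by blast
    also have "?r ` partitions_in_box N N = box_shapes N N"
      by (rule bij_betw_imp_surj_on[OF bij_betw_partitions_in_box])
    finally show "bij_betw ?r ?P {f \<in> box_shapes N N. f 0 = N}"
      by (rule bij_betw_subset[OF bij_betw_partitions_in_box Collect_restrict])
  qed
  finally show ?thesis .
qed

text \<open>The first part of the dual counts the rows that are not full, and no row is full as soon
  as the longest one is not.\<close>

lemma dual_shape_0_eq_iff:
  assumes "f \<in> box_shapes N N" "N \<ge> 1"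
  shows "dual_shape N N f 0 = N \<longleftrightarrow> f 0 < N"
proof -
  have "dual_shape N N f 0 < N \<longleftrightarrow> N \<le> f 0"
    using dual_shape_less_iff[of N f 0 0 N] assms by (simp add: box_shapes_def)
  moreover have "dual_shape N N f 0 \<le> N"
    using box_shapes_le[OF dual_shape_in_box] assms(2) by simp
  ultimately show ?thesis by linarith
qed

theorem F_add_F_swap:
  assumes "N \<ge> 1"
  shows "F N \<chi> \<delta> + F N \<delta> \<chi> = (\<Prod>j<N. \<Prod>i<N. \<delta> (Suc i) + \<chi> (Suc j))"
proof -
  let ?B = "box_shapes N N" and ?d = "dual_shape N N"
  let ?t = "\<lambda>f. gt_sum \<delta> N f * gt_sum \<chi> N (?d f)"
  have "F N \<delta> \<chi> = (\<Sum>f\<in>{f \<in> ?B. f 0 = N}. gt_sum \<chi> N f * gt_sum \<delta> N (?d f))"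
    by (rule F_eq_sum_gt_sum[OF assms])
  also have "\<dots> = (\<Sum>f\<in>{f \<in> ?B. f 0 \<noteq> N}. ?t f)"
  \<comment> \<open>The involution \<open>?d\<close> negates the condition \<open>f 0 = N\<close>
    and interchanges the two Gelfand-Tsetlin factors.\<close>
  proof (rule sum.reindex_bij_witness[where i = ?d and j = ?d])
    fix f assume "f \<in> {f \<in> ?B. f 0 = N}"
    then have f: "f \<in> ?B" "\<not> f 0 < N" by simp_all
    show dd: "?d (?d f) = f" by (rule dual_shape_dual_shape[OF f(1)])
    show "?d f \<in> {f \<in> ?B. f 0 \<noteq> N}"
      using dual_shape_0_eq_iff[OF f(1) assms] f(2) dual_shape_in_box by blast
    show "?t (?d f) = gt_sum \<chi> N f * gt_sum \<delta> N (?d f)"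
      by (simp only: dd mult.commute)
  next
    fix f assume "f \<in> {f \<in> ?B. f 0 \<noteq> N}"
    then have f: "f \<in> ?B" "f 0 < N" using box_shapes_le[of f N N 0] assms by simp_all
    show "?d (?d f) = f" by (rule dual_shape_dual_shape[OF f(1)])
    show "?d f \<in> {f \<in> ?B. f 0 = N}"
      using dual_shape_0_eq_iff[OF f(1) assms] f(2) dual_shape_in_box by blast
  qed
  finally have "F N \<chi> \<delta> + F N \<delta> \<chi> =
      (\<Sum>f\<in>{f \<in> ?B. f 0 = N}. ?t f) + (\<Sum>f\<in>{f \<in> ?B. f 0 \<noteq> N}. ?t f)"
    by (simp only: F_eq_sum_gt_sum[OF assms])
  also have "\<dots> = (\<Sum>f\<in>{f \<in> ?B. f 0 = N} \<union> {f \<in> ?B. f 0 \<noteq> N}. ?t f)"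
    by (rule sum.union_disjoint[symmetric]) (auto simp: finite_box_shapes)
  also have "{f \<in> ?B. f 0 = N} \<union> {f \<in> ?B. f 0 \<noteq> N} = ?B" by blast
  finally show ?thesis by (simp only: gt_sum_dual_cauchy)
qed

theorem mainTheorem2:
  fixes N :: nat and \<delta> \<chi> :: "'a::comm_ring_1"
  assumes "N \<ge> 1"
  shows "F N (\<lambda>_. \<chi>) (\<lambda>_. \<delta>) + F N (\<lambda>_. \<delta>) (\<lambda>_. \<chi>) =
    (\<Sum>k=0..N^2. of_nat (N^2 choose k) * \<delta>^k * \<chi>^(N^2 - k))"
proof -
  \<comment> \<open>After the specialization all \<open>N * N\<close> factors of the product equal
    \<open>\<delta> + \<chi>\<close>.\<close>
  have "F N (\<lambda>_. \<chi>) (\<lambda>_. \<delta>) + F N (\<lambda>_. \<delta>) (\<lambda>_. \<chi>) = (\<delta> + \<chi>) ^ (N\<^sup>2)"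
    by (simp add: F_add_F_swap[OF assms] power_mult[symmetric] power2_eq_square)
  then show ?thesis by (simp only: binomial_ring atLeast0AtMost)
qed

end
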